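(* When more than half of the agents collude, no incentive-compatible payment mechanism can make truth-telling the dominant strategy for the colluders. Precisely: in the model described in the context, let $N_{col}\le N$ with $N_{col}>N/2$, let $\bar N=N-N_{col}$, and let $\Lambda>0$. Then there is no payment scheme $\tau$ satisfying, for every $c\in\{0,\dots,N_{col}-1\}$, $$\sum_{n=0}^{\bar N}\bar P_0(n)\big(\tau(0,n+c)-\tau(1,n+c)\big)\ge\Lambda\quad\text{and}\quad\sum_{n=0}^{\bar N}\bar P_1(n)\big(\tau(1,n+c)-\tau(0,n+c)\big)\ge\Lambda .$$
   Context: $\Theta$ is a finite set of types with prior $\Pr[\theta]\ge0$, $\sum_\theta\Pr[\theta]=1$; each type $\theta$ has a probability $p_\theta=\Pr[\text{signal }1\mid\theta]\in[0,1]$, with $p_{\theta_1}\ne p_{\theta_2}$ for $\theta_1\neq\theta_2$. There are $N\ge1$ agents whose binary signals are, conditionally on the type $\theta$, independent and equal to $1$ with probability $p_\theta$ (and to $0$ otherwise). Of these, $N_{col}$ agents may collude, while the remaining $\bar N=N-N_{col}$ agents report their observed signals honestly. For $o\in\{0,1\}$, $\Pr[o\mid\theta]$ is $p_\theta$ if $o=1$ and $1-p_\theta$ if $o=0$; $\Pr[o]=\sum_\theta\Pr[o\mid\theta]\Pr[\theta]$, assumed positive for $o=0,1$; and $\Pr[\theta\mid o]=\Pr[o\mid\theta]\Pr[\theta]/\Pr[o]$. For $n\in\{0,\dots,\bar N\}$, $\bar P_o(n)=\sum_\theta\Pr[\theta\mid o]\binom{\bar N}{n}p_\theta^{\,n}(1-p_\theta)^{\bar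 N-n}$ is the probability that exactly $n$ of the $\bar N$ honest agents report $1$, given that a colluder observed $o$. A payment scheme is a collection of reals $\tau(r,n)\ge0$, $r\in\{0,1\}$, $n\in\{0,\dots,N-1\}$: the amount paid to an agent who reports $r$ when exactly $n$ of the other $N-1$ agents report $1$. Truth-telling is a dominant strategy for the colluders (with margin $\Lambda>0$, given that the $\bar N$ non-colluders are honest) if, whatever the number $c\in\{0,\dots,N_{col}-1\}$ of positive reports submitted by the other $N_{col}-1$ colluders, a colluder's expected payment from reporting her observed signal exceeds that from reporting the opposite by at least $\Lambda$; these are the inequalities displayed in the claim. *)

theory Defs
  imports Complex_Main
begin

text \<open>
  Signals and reports are encoded as booleans: \<open>True\<close> stands for 1 and \<open>False\<close> for 0.
  \<open>\<Theta>\<close> is the set of types, \<open>prior \<theta>\<close> is Pr[\<open>\<theta>\<close>] and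
  \<open>p \<theta>\<close> is Pr[signal 1 | \<open>\<theta>\<close>].
\<close>

definition signal_given_type :: "('a \<Rightarrow> real) \<Rightarrow> bool \<Rightarrow> 'a \<Rightarrow> real" where
  "signal_given_type p s \<theta> = (if s then p \<theta> else 1 - p \<theta>)"

definition signal_prob :: "'a set \<Rightarrow> ('a \<Rightarrow> real) \<Rightarrow> ('a \<Rightarrow> real) \<Rightarrow> bool \<Rightarrow> real" where
  "signal_prob \<Theta> prior p s = (\<Sum>\<theta>\<in>\<Theta>. signal_given_type p s \<theta> * prior \<theta>)"

definition type_given_signal ::
    "'a set \<Rightarrow> ('a \<Rightarrow> real) \<Rightarrow> ('a \<Rightarrow> real) \<Rightarrow> bool \<Rightarrow> 'a \<Rightarrow> real" where
  "type_given_signal \<Theta> prior p s \<theta> =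
     signal_given_type p s \<theta> * prior \<theta> / signal_prob \<Theta> prior p s"

locale binary_signal_model =
  fixes \<Theta> :: "'a set" and prior :: "'a \<Rightarrow> real" and p :: "'a \<Rightarrow> real"
  assumes finite_types: "finite \<Theta>"
    and prior_nonneg: "\<And>\<theta>. \<theta> \<in> \<Theta> \<Longrightarrow> prior \<theta> \<ge> 0"
    and prior_sum: "(\<Sum>\<theta>\<in>\<Theta>. prior \<theta>) = 1"
    and signal_range: "\<And>\<theta>. \<theta> \<in> \<Theta> \<Longrightarrow> 0 \<le> p \<theta> \<and> p \<theta> \<le> 1"
    and types_distinct: "\<And>\<theta>1 \<theta>2. \<theta>1 \<in> \<Theta> \<Longrightarrow> \<theta>2 \<in> \<Theta> \<Longrightarrow> \<theta>1 \<noteq> \<theta>2 \<Longrightarrow> p \<theta>1 \<noteq> p \<theta>2"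
    and signal_pos: "\<And>s. signal_prob \<Theta> prior p s > 0"

text \<open>
  The probability that exactly \<open>n\<close> of \<open>H\<close> honest agents report 1, given that a colluder
  observed \<open>s\<close>: conditionally on the type, the honest signals are independent of each other and
  of the colluder's signal, so their number of ones is binomial.
\<close>

definition honest_count_prob ::
    "'a set \<Rightarrow> ('a \<Rightarrow> real) \<Rightarrow> ('a \<Rightarrow> real) \<Rightarrow> nat \<Rightarrow> bool \<Rightarrow> nat \<Rightarrow> real" where
  "honest_count_prob \<Theta> prior p H s n =
     (\<Sum>\<theta>\<in>\<Theta>. type_given_signal \<Theta> prior p s \<theta>
               * (real (H choose n) * p \<theta> ^ n * (1 - p \<theta>) ^ (H - n)))"

text \<open>
  \<open>\<tau> r n\<close> is paid to an agent reporting \<open>r\<close> when exactly \<open>n\<close> of the other \<open>N - 1\<close> agents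
  report 1; values of \<open>\<tau>\<close> at \<open>n \<ge> N\<close> are meaningless and left unconstrained.
\<close>

definition payment_scheme :: "nat \<Rightarrow> (bool \<Rightarrow> nat \<Rightarrow> real) \<Rightarrow> bool" where
  "payment_scheme N \<tau> \<longleftrightarrow> (\<forall>r. \<forall>n<N. \<tau> r n \<ge> 0)"

text \<open>
  Here \<open>c\<close> is the number of positive reports among the other \<open>Ncol - 1\<close> colluders, \<open>n\<close> the number
  among the \<open>N - Ncol\<close> honest agents; the two conjuncts are for a colluder observing 0 and 1.
\<close>

definition truth_telling_dominant ::
    "'a set \<Rightarrow> ('a \<Rightarrow> real) \<Rightarrow> ('a \<Rightarrow> real) \<Rightarrow> nat \<Rightarrow> nat \<Rightarrow> real \<Rightarrow>
     (bool \<Rightarrow> nat \<Rightarrow> real) \<Rightarrow> bool" where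
  "truth_telling_dominant \<Theta> prior p N Ncol \<Lambda> \<tau> \<longleftrightarrow>
     (\<forall>c<Ncol.
        (\<Sum>n=0..N - Ncol. honest_count_prob \<Theta> prior p (N - Ncol) False n
                             * (\<tau> False (n + c) - \<tau> True (n + c))) \<ge> \<Lambda> \<and>
        (\<Sum>n=0..N - Ncol. honest_count_prob \<Theta> prior p (N - Ncol) True n
                             * (\<tau> True (n + c) - \<tau> False (n + c))) \<ge> \<Lambda>)"

end

theory Submission
  imports Defs
begin

text \<open>
  Write \<open>H = N - Ncol\<close>, \<open>d n = \<tau> True n - \<tau> False n\<close> and \<open>P s = honest_count_prob \<Theta> prior p H s\<close>.
  As \<open>H < Ncol\<close>, the incentive inequalities hold for all \<open>c \<le> H\<close>. Averaging those for signal 1 over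
  \<open>c\<close> with weights \<open>P False c\<close>, and those for signal 0 with weights \<open>P True c\<close>, bounds the same double
  sum \<open>\<Sum>c n. P False c * P True n * d (n + c)\<close> below by \<open>\<Lambda>\<close> and above by \<open>- \<Lambda>\<close>.
\<close>

text \<open>The shift \<open>n + c\<close> is symmetric in its two indices, so after exchanging the
  sums the weights \<open>a\<close> and \<open>b\<close> trade roles.\<close>

lemma sum_weighted_shift_commute:
  fixes a b d :: "nat \<Rightarrow> 'b::comm_semiring_0"
  shows "(\<Sum>c\<in>A. a c * (\<Sum>n\<in>B. b n * d (n + c))) = (\<Sum>n\<in>B. b n * (\<Sum>c\<in>A. a c * d (c + n)))"
  by (simp add: sum_distrib_left sum.swap[of _ B A] ac_simps)

context binary_signal_model
begin

lemma type_given_signal_nonneg: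
  assumes "\<theta> \<in> \<Theta>"
  shows "0 \<le> type_given_signal \<Theta> prior p s \<theta>"
  using prior_nonneg[OF assms] signal_range[OF assms] signal_pos[of s]
  by (simp add: type_given_signal_def signal_given_type_def)

lemma sum_type_given_signal: "(\<Sum>\<theta>\<in>\<Theta>. type_given_signal \<Theta> prior p s \<theta>) = 1"
  using signal_pos[of s]
  by (simp add: type_given_signal_def flip: sum_divide_distrib signal_prob_def)

lemma honest_count_prob_nonneg: "0 \<le> honest_count_prob \<Theta> prior p H s n"
  unfolding honest_count_prob_def
  using type_given_signal_nonneg signal_range by (intro sum_nonneg mult_nonneg_nonneg) auto

lemma sum_honest_count_prob: "(\<Sum>n=0..H. honest_count_prob \<Theta> prior p H s n) = 1"
proof -
  \<comment> \<open>Binomial theorem for \<open>(q + (1 - q)) ^ H\<close>.\<close>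
  have binomial: "(\<Sum>n=0..H. real (H choose n) * q ^ n * (1 - q) ^ (H - n)) = 1" for q :: real
    using binomial_ring[of q "1 - q" H] by (simp add: atLeast0AtMost)
  have "(\<Sum>n=0..H. honest_count_prob \<Theta> prior p H s n)
      = (\<Sum>\<theta>\<in>\<Theta>. type_given_signal \<Theta> prior p s \<theta>
           * (\<Sum>n=0..H. real (H choose n) * p \<theta> ^ n * (1 - p \<theta>) ^ (H - n)))"
    unfolding honest_count_prob_def sum_distrib_left by (rule sum.swap)
  then show ?thesis
    by (simp add: binomial sum_type_given_signal)
qed

text \<open>The weights form a probability distribution on \<open>{0..H}\<close>, so the average
  inherits any bound valid there.\<close>

lemma honest_count_average_ge:
  assumes "\<And>c. c \<le> H \<Longrightarrow> L \<le> f c"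
  shows "L \<le> (\<Sum>c=0..H. honest_count_prob \<Theta> prior p H s c * f c)"
proof -
  have "L = (\<Sum>c=0..H. honest_count_prob \<Theta> prior p H s c * L)"
    by (simp add: sum_honest_count_prob flip: sum_distrib_right)
  also have "\<dots> \<le> (\<Sum>c=0..H. honest_count_prob \<Theta> prior p H s c * f c)"
    using assms by (intro sum_mono mult_left_mono honest_count_prob_nonneg) auto
  finally show ?thesis .
qed

lemma not_truth_telling_dominant:
  assumes "N - Ncol < Ncol" and "0 < \<Lambda>"
  shows "\<not> truth_telling_dominant \<Theta> prior p N Ncol \<Lambda> \<tau>"
proof
  assume dominant: "truth_telling_dominant \<Theta> prior p N Ncol \<Lambda> \<tau>"
  define H where "H = N - Ncol"
  define P where "P = honest_count_prob \<Theta> prior p H"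
  define d where "d n = \<tau> True n - \<tau> False n" for n
  have true_ge: "\<Lambda> \<le> (\<Sum>n=0..H. P True n * d (n + c))"
    and false_ge: "\<Lambda> \<le> - (\<Sum>n=0..H. P False n * d (n + c))" if "c \<le> H" for c
    using dominant that assms(1)
    by (auto simp: truth_telling_dominant_def H_def P_def d_def right_diff_distrib
        simp flip: sum_negf)
  have "\<Lambda> \<le> (\<Sum>c=0..H. P False c * (\<Sum>n=0..H. P True n * d (n + c)))"
    using true_ge unfolding P_def by (rule honest_count_average_ge)
  moreover have "\<Lambda> \<le> (\<Sum>c=0..H. P True c * - (\<Sum>n=0..H. P False n * d (n + c)))"
    using false_ge unfolding P_def by (rule honest_count_average_ge)
  \<comment> \<open>After the exchange of sums the second average is the negative of the first, so a
    number and its negative would both be at least \<open>\<Lambda>\<close>, which is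
    positive.\<close>
  ultimately show False
    using sum_weighted_shift_commute[of "P False" "P True" d "{0..H}" "{0..H}"] \<open>0 < \<Lambda>\<close>
    by (simp add: sum_negf)
qed

end

theorem proposition4p7:
  fixes \<Theta> :: "'a set" and prior p :: "'a \<Rightarrow> real" and N Ncol :: nat and \<Lambda> :: real
  assumes "binary_signal_model \<Theta> prior p"
    and "N \<ge> 1"
    and "Ncol \<le> N"
    and "real Ncol > real N / 2"
    and "\<Lambda> > 0"
  shows "\<not> (\<exists>\<tau>. payment_scheme N \<tau> \<and> truth_telling_dominant \<Theta> prior p N Ncol \<Lambda> \<tau>)"
proof -
  have "N - Ncol < Ncol"
    using assms(3,4) by linarith
  then show ?thesis
    using binary_signal_model.not_truth_telling_dominant[OF assms(1)] assms(5) by blast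
qed

end
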